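(* Let $(L,\tau)$ be a compact topological residuated lattice. Then the following conditions are equivalent: (i) $(L,\tau)$ is residually finite; (ii) $(L,\tau)$ is profinite; (iii) $(L,\tau)$ is topologically isomorphic to a closed subdirect product of finite discrete residuated lattices.
   Context: A residuated lattice is an algebra $(L,\wedge,\vee,\odot,\rightarrow,0,1)$ such that $(L,\wedge,\vee,0,1)$ is a bounded lattice, $(L,\odot,1)$ is a commutative monoid, and $x\odot y\leq z$ iff $x\leq y\rightarrow z$ for all $x,y,z\in L$. Homomorphisms preserve all these operations and constants. A topological residuated lattice $(L,\tau)$ is a residuated lattice with a topology $\tau$ for which all operations are continuous. Compact means that every open cover has a finite subcover (Hausdorffness is not included). Topologically isomorphic means isomorphic via an algebra isomorphism that is a homeomorphism. $(L,\tau)$ is residually finite if for any two distinct $x,y\in L$ there are a finite residuated lattice $A$ with the discrete topology and a continuous homomorphism $\varphi:L\to A$ with $\varphi(x)\neq\varphi(y)$. $(L,\tau)$ is profinite if it is topologically isomorphic to the inverse limit of an inverse system (indexed by a directed poset, with homomorphisms as connecting maps) of finite discrete residuated lattices; the inverse limit $\{(b_i)\in\prod_i L_i:\pi_{ij}(b_i)=b_j \text{ for } j\le i\}$ carries the subspace topology of the product topology. A closed subdirect product of a family $(L_i)_{i\in I}$ of finite discrete residuated lattices is a subalgebra of $\prod_{i\in I}L_i$ that is closed in the product topology (and carries the subspace topology) and whose projection to each factor $L_i$ is onto. *)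

theory Defs
  imports "HOL-Analysis.Analysis" "HOL-Algebra.Group"
begin

text \<open>The monoid operation and the constant 1 are the fields \<open>mult\<close> and \<open>one\<close> of the monoid record.\<close>

record 'a reslat = "'a monoid" +
  rl_meet :: "'a \<Rightarrow> 'a \<Rightarrow> 'a"
  rl_join :: "'a \<Rightarrow> 'a \<Rightarrow> 'a"
  rl_imp :: "'a \<Rightarrow> 'a \<Rightarrow> 'a"
  rl_bot :: 'a

definition rl_le :: "'a reslat \<Rightarrow> 'a \<Rightarrow> 'a \<Rightarrow> bool"
  where "rl_le L x y \<longleftrightarrow> rl_meet L x y = x"

text \<open>The one-element algebra, where 0 = 1, is a residuated lattice.\<close>

locale residuated_lattice = comm_monoid L for L :: "'a reslat" (structure) +
  assumes meet_closed: "x \<in> carrier L \<Longrightarrow> y \<in> carrier L \<Longrightarrow> rl_meet L x y \<in> carrier L"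
    and join_closed: "x \<in> carrier L \<Longrightarrow> y \<in> carrier L \<Longrightarrow> rl_join L x y \<in> carrier L"
    and imp_closed: "x \<in> carrier L \<Longrightarrow> y \<in> carrier L \<Longrightarrow> rl_imp L x y \<in> carrier L"
    and bot_closed: "rl_bot L \<in> carrier L"
    and meet_assoc: "x \<in> carrier L \<Longrightarrow> y \<in> carrier L \<Longrightarrow> z \<in> carrier L \<Longrightarrow>
      rl_meet L (rl_meet L x y) z = rl_meet L x (rl_meet L y z)"
    and meet_comm: "x \<in> carrier L \<Longrightarrow> y \<in> carrier L \<Longrightarrow> rl_meet L x y = rl_meet L y x"
    and join_assoc: "x \<in> carrier L \<Longrightarrow> y \<in> carrier L \<Longrightarrow> z \<in> carrier L \<Longrightarrow>
      rl_join L (rl_join L x y) z = rl_join L x (rl_join L y z)"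
    and join_comm: "x \<in> carrier L \<Longrightarrow> y \<in> carrier L \<Longrightarrow> rl_join L x y = rl_join L y x"
    and meet_absorb: "x \<in> carrier L \<Longrightarrow> y \<in> carrier L \<Longrightarrow> rl_meet L x (rl_join L x y) = x"
    and join_absorb: "x \<in> carrier L \<Longrightarrow> y \<in> carrier L \<Longrightarrow> rl_join L x (rl_meet L x y) = x"
    and bot_least: "x \<in> carrier L \<Longrightarrow> rl_le L (rl_bot L) x"
    and one_greatest: "x \<in> carrier L \<Longrightarrow> rl_le L x \<one>"
    and residuation: "x \<in> carrier L \<Longrightarrow> y \<in> carrier L \<Longrightarrow> z \<in> carrier L \<Longrightarrow>
      rl_le L (x \<otimes> y) z \<longleftrightarrow> rl_le L x (rl_imp L y z)"

definition rl_hom :: "'a reslat \<Rightarrow> 'b reslat \<Rightarrow> ('a \<Rightarrow> 'b) set"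
  where "rl_hom L M = {f \<in> carrier L \<rightarrow> carrier M.
    (\<forall>x\<in>carrier L. \<forall>y\<in>carrier L.
       f (rl_meet L x y) = rl_meet M (f x) (f y) \<and>
       f (rl_join L x y) = rl_join M (f x) (f y) \<and>
       f (x \<otimes>\<^bsub>L\<^esub> y) = f x \<otimes>\<^bsub>M\<^esub> f y \<and>
       f (rl_imp L x y) = rl_imp M (f x) (f y)) \<and>
    f (rl_bot L) = rl_bot M \<and> f \<one>\<^bsub>L\<^esub> = \<one>\<^bsub>M\<^esub>}"

definition rl_subalgebra :: "'a set \<Rightarrow> 'a reslat \<Rightarrow> bool"
  where "rl_subalgebra S L \<longleftrightarrow> S \<subseteq> carrier L \<and>
    (\<forall>x\<in>S. \<forall>y\<in>S. rl_meet L x y \<in> S \<and> rl_join L x y \<in> S \<and> x \<otimes>\<^bsub>L\<^esub> y \<in> S \<and> rl_imp L x y \<in> S) \<and>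
    rl_bot L \<in> S \<and> \<one>\<^bsub>L\<^esub> \<in> S"

definition rl_product :: "'i set \<Rightarrow> ('i \<Rightarrow> 'b reslat) \<Rightarrow> ('i \<Rightarrow> 'b) reslat"
  where "rl_product I A =
    \<lparr>carrier = (\<Pi>\<^sub>E i\<in>I. carrier (A i)),
     mult = (\<lambda>x y. \<lambda>i\<in>I. x i \<otimes>\<^bsub>A i\<^esub> y i),
     one = (\<lambda>i\<in>I. \<one>\<^bsub>A i\<^esub>),
     rl_meet = (\<lambda>x y. \<lambda>i\<in>I. rl_meet (A i) (x i) (y i)),
     rl_join = (\<lambda>x y. \<lambda>i\<in>I. rl_join (A i) (x i) (y i)),
     rl_imp = (\<lambda>x y. \<lambda>i\<in>I. rl_imp (A i) (x i) (y i)),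
     rl_bot = (\<lambda>i\<in>I. rl_bot (A i))\<rparr>"

definition topological_residuated_lattice :: "'a reslat \<Rightarrow> 'a topology \<Rightarrow> bool"
  where "topological_residuated_lattice L T \<longleftrightarrow>
    residuated_lattice L \<and> topspace T = carrier L \<and>
    continuous_map (prod_topology T T) T (\<lambda>(x, y). rl_meet L x y) \<and>
    continuous_map (prod_topology T T) T (\<lambda>(x, y). rl_join L x y) \<and>
    continuous_map (prod_topology T T) T (\<lambda>(x, y). x \<otimes>\<^bsub>L\<^esub> y) \<and>
    continuous_map (prod_topology T T) T (\<lambda>(x, y). rl_imp L x y)"

definition topologically_isomorphic ::
    "'a reslat \<Rightarrow> 'a topology \<Rightarrow> 'b reslat \<Rightarrow> 'b topology \<Rightarrow> bool"
  where "topologically_isomorphic L T M U \<longleftrightarrow>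
    (\<exists>f \<in> rl_hom L M. bij_betw f (carrier L) (carrier M) \<and> homeomorphic_map T U f)"

definition finite_residuated_lattice :: "'b reslat \<Rightarrow> bool"
  where "finite_residuated_lattice A \<longleftrightarrow> residuated_lattice A \<and> finite (carrier A)"

text \<open>
  HOL cannot quantify over types inside a formula. The existentially quantified finite algebras
  therefore have carriers in a type \<open>'b\<close>, and index sets are sets over a type \<open>'i\<close>; both types
  are parameters of the three notions below. Every finite algebra has an isomorphic copy over \<open>nat\<close>.
\<close>

definition residually_finite :: "'b itself \<Rightarrow> 'a reslat \<Rightarrow> 'a topology \<Rightarrow> bool"
  where "residually_finite _ L T \<longleftrightarrow>
    (\<forall>x\<in>carrier L. \<forall>y\<in>carrier L. x \<noteq> y \<longrightarrow>
      (\<exists>(A :: 'b reslat) \<phi>. finite_residuated_lattice A \<and> \<phi> \<in> rl_hom L A \<and>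
        continuous_map T (discrete_topology (carrier A)) \<phi> \<and> \<phi> x \<noteq> \<phi> y))"

definition discrete_product_topology :: "'i set \<Rightarrow> ('i \<Rightarrow> 'b reslat) \<Rightarrow> ('i \<Rightarrow> 'b) topology"
  where "discrete_product_topology I A = product_topology (\<lambda>i. discrete_topology (carrier (A i))) I"

text \<open>\<open>(j, i) \<in> r\<close> stands for \<open>j \<le> i\<close>.\<close>

definition directed_poset :: "'i set \<Rightarrow> 'i rel \<Rightarrow> bool"
  where "directed_poset I r \<longleftrightarrow> I \<noteq> {} \<and> partial_order_on I r \<and>
    (\<forall>i\<in>I. \<forall>j\<in>I. \<exists>k\<in>I. (i, k) \<in> r \<and> (j, k) \<in> r)"

text \<open>\<open>p i j\<close> is the connecting map from \<open>A i\<close> to \<open>A j\<close>, for \<open>j \<le> i\<close>.\<close>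

definition inverse_system ::
    "'i set \<Rightarrow> 'i rel \<Rightarrow> ('i \<Rightarrow> 'b reslat) \<Rightarrow> ('i \<Rightarrow> 'i \<Rightarrow> 'b \<Rightarrow> 'b) \<Rightarrow> bool"
  where "inverse_system I r A p \<longleftrightarrow> directed_poset I r \<and>
    (\<forall>i\<in>I. residuated_lattice (A i)) \<and>
    (\<forall>i j. (j, i) \<in> r \<longrightarrow> p i j \<in> rl_hom (A i) (A j)) \<and>
    (\<forall>i\<in>I. \<forall>a\<in>carrier (A i). p i i a = a) \<and>
    (\<forall>i j k. (k, j) \<in> r \<longrightarrow> (j, i) \<in> r \<longrightarrow> (\<forall>a\<in>carrier (A i). p j k (p i j a) = p i k a))"

definition inverse_limit_set ::
    "'i set \<Rightarrow> 'i rel \<Rightarrow> ('i \<Rightarrow> 'b reslat) \<Rightarrow> ('i \<Rightarrow> 'i \<Rightarrow> 'b \<Rightarrow> 'b) \<Rightarrow> ('i \<Rightarrow> 'b) set"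
  where "inverse_limit_set I r A p =
    {b \<in> carrier (rl_product I A). \<forall>i j. (j, i) \<in> r \<longrightarrow> p i j (b i) = b j}"

definition profinite :: "'i itself \<Rightarrow> 'b itself \<Rightarrow> 'a reslat \<Rightarrow> 'a topology \<Rightarrow> bool"
  where "profinite _ _ L T \<longleftrightarrow>
    (\<exists>(I :: 'i set) r (A :: 'i \<Rightarrow> 'b reslat) p.
      inverse_system I r A p \<and> (\<forall>i\<in>I. finite_residuated_lattice (A i)) \<and>
      topologically_isomorphic L T
        ((rl_product I A)\<lparr>carrier := inverse_limit_set I r A p\<rparr>)
        (subtopology (discrete_product_topology I A) (inverse_limit_set I r A p)))"

definition closed_subdirect_product :: "'i set \<Rightarrow> ('i \<Rightarrow> 'b reslat) \<Rightarrow> ('i \<Rightarrow> 'b) set \<Rightarrow> bool"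
  where "closed_subdirect_product I A S \<longleftrightarrow>
    rl_subalgebra S (rl_product I A) \<and> closedin (discrete_product_topology I A) S \<and>
    (\<forall>i\<in>I. (\<lambda>x. x i) ` S = carrier (A i))"

definition iso_closed_subdirect_product ::
    "'i itself \<Rightarrow> 'b itself \<Rightarrow> 'a reslat \<Rightarrow> 'a topology \<Rightarrow> bool"
  where "iso_closed_subdirect_product _ _ L T \<longleftrightarrow>
    (\<exists>(I :: 'i set) (A :: 'i \<Rightarrow> 'b reslat) S.
      (\<forall>i\<in>I. finite_residuated_lattice (A i)) \<and> closed_subdirect_product I A S \<and>
      topologically_isomorphic L T
        ((rl_product I A)\<lparr>carrier := S\<rparr>) (subtopology (discrete_product_topology I A) S))"

end

(*
The kernels of the continuous homomorphisms from L to finite algebras form a set of relations on L,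
directed by reverse inclusion since a finite product of finite algebras is finite; the corresponding
quotients, copied to nat, form an inverse system. The canonical map into its limit is injective
exactly by residual finiteness, and onto because the fibres over a compatible family are closed
with the finite intersection property. A continuous bijection from a compact space to a Hausdorff
space is a homeomorphism, and its image in the product is compact, hence closed.
Conversely, the projections of a product of finite algebras separate points.
*)
theory Submission
  imports Defs
begin

section \<open>Homomorphisms, subalgebras and separating families\<close>

lemma rl_homD:
  assumes "f \<in> rl_hom L M"
  shows "x \<in> carrier L \<Longrightarrow> f x \<in> carrier M"
    and "\<lbrakk>x \<in> carrier L; y \<in> carrier L\<rbrakk> \<Longrightarrow> f (rl_meet L x y) = rl_meet M (f x) (f y)"
    and "\<lbrakk>x \<in> carrier L; y \<in> carrier L\<rbrakk> \<Longrightarrow> f (rl_join L x y) = rl_join M (f x) (f y)"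
    and "\<lbrakk>x \<in> carrier L; y \<in> carrier L\<rbrakk> \<Longrightarrow> f (x \<otimes>\<^bsub>L\<^esub> y) = f x \<otimes>\<^bsub>M\<^esub> f y"
    and "\<lbrakk>x \<in> carrier L; y \<in> carrier L\<rbrakk> \<Longrightarrow> f (rl_imp L x y) = rl_imp M (f x) (f y)"
    and "f (rl_bot L) = rl_bot M"
    and "f \<one>\<^bsub>L\<^esub> = \<one>\<^bsub>M\<^esub>"
  using assms by (auto simp: rl_hom_def)

lemma rl_subalgebraD:
  assumes "rl_subalgebra S L"
  shows "x \<in> S \<Longrightarrow> x \<in> carrier L"
    and "\<lbrakk>x \<in> S; y \<in> S\<rbrakk> \<Longrightarrow> rl_meet L x y \<in> S"
    and "\<lbrakk>x \<in> S; y \<in> S\<rbrakk> \<Longrightarrow> rl_join L x y \<in> S"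
    and "\<lbrakk>x \<in> S; y \<in> S\<rbrakk> \<Longrightarrow> x \<otimes>\<^bsub>L\<^esub> y \<in> S"
    and "\<lbrakk>x \<in> S; y \<in> S\<rbrakk> \<Longrightarrow> rl_imp L x y \<in> S"
    and "rl_bot L \<in> S"
    and "\<one>\<^bsub>L\<^esub> \<in> S"
  using assms by (auto simp: rl_subalgebra_def)

lemma (in residuated_lattice) rl_subalgebra_carrier: "rl_subalgebra (carrier L) L"
  by (simp add: rl_subalgebra_def meet_closed join_closed imp_closed bot_closed)

lemma rl_hom_compose:
  assumes "f \<in> rl_hom L M" "g \<in> rl_hom M N"
  shows "(\<lambda>x. g (f x)) \<in> rl_hom L N"
  using assms by (auto simp: rl_hom_def Pi_iff)

lemma rl_subalgebra_image:
  assumes L: "rl_subalgebra (carrier L) L" and f: "f \<in> rl_hom L M"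
  shows "rl_subalgebra (f ` carrier L) M"
proof -
  note [simp] = rl_homD(2-7)[OF f, symmetric]
  show ?thesis
    using rl_subalgebraD[OF L] rl_homD(1)[OF f] by (auto simp: rl_subalgebra_def)
qed

text \<open>Apart from closure, which is assumed of \<open>B\<close>, every axiom is an identity or,
  since the order is the equation \<open>rl_meet B x y = x\<close>, an equivalence of two equations.
  A jointly injective family of homomorphisms both preserves and reflects equations. If
  \<open>I\<close> is empty, \<open>sep\<close> makes \<open>B\<close> a one-element algebra. The
  applications are products, separated by their projections, and copies, separated by a single
  injective map.\<close>

lemma residuated_lattice_if_separating_homs:
  assumes B: "rl_subalgebra (carrier B) B"
    and A: "\<And>i. i \<in> I \<Longrightarrow> residuated_lattice (A i)"
    and h: "\<And>i. i \<in> I \<Longrightarrow> h i \<in> rl_hom B (A i)"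
    and sep: "\<And>x y. \<lbrakk>x \<in> carrier B; y \<in> carrier B; \<And>i. i \<in> I \<Longrightarrow> h i x = h i y\<rbrakk> \<Longrightarrow> x = y"
  shows "residuated_lattice B"
proof -
  note [simp] = rl_subalgebraD(2-7)[OF B] rl_homD[OF h]
  have le: "rl_le B x y \<longleftrightarrow> (\<forall>i\<in>I. rl_le (A i) (h i x) (h i y))"
    if "x \<in> carrier B" "y \<in> carrier B" for x y
  proof
    assume "rl_le B x y"
    then have "h i (rl_meet B x y) = h i x" for i
      by (simp add: rl_le_def)
    then show "\<forall>i\<in>I. rl_le (A i) (h i x) (h i y)"
      using that by (metis rl_homD(2)[OF h] rl_le_def)
  next
    assume "\<forall>i\<in>I. rl_le (A i) (h i x) (h i y)"
    then show "rl_le B x y"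
      unfolding rl_le_def by (intro sep) (use that in \<open>auto simp: rl_le_def\<close>)
  qed
  have m: "comm_monoid (A i)" if "i \<in> I" for i
    using A[OF that] by (simp add: residuated_lattice_def)
  have m': "monoid (A i)" if "i \<in> I" for i
    using m[OF that] by (simp add: comm_monoid_def)
  show ?thesis
  proof unfold_locales
    fix x y z assume "x \<in> carrier B" "y \<in> carrier B" "z \<in> carrier B"
    then show "x \<otimes>\<^bsub>B\<^esub> y \<otimes>\<^bsub>B\<^esub> z = x \<otimes>\<^bsub>B\<^esub> (y \<otimes>\<^bsub>B\<^esub> z)"
      by (intro sep) (simp_all add: monoid.m_assoc[OF m'])
  next
    fix x assume "x \<in> carrier B"
    then show "\<one>\<^bsub>B\<^esub> \<otimes>\<^bsub>B\<^esub> x = x" "x \<otimes>\<^bsub>B\<^esub> \<one>\<^bsub>B\<^esub> = x"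
      by (intro sep; simp add: monoid.l_one[OF m'] monoid.r_one[OF m'])+
  next
    fix x y assume "x \<in> carrier B" "y \<in> carrier B"
    then show "x \<otimes>\<^bsub>B\<^esub> y = y \<otimes>\<^bsub>B\<^esub> x"
      by (intro sep) (simp_all add: comm_monoid.m_comm[OF m])
  next
    fix x y assume "x \<in> carrier B" "y \<in> carrier B"
    then show "rl_meet B x y = rl_meet B y x" "rl_join B x y = rl_join B y x"
      "rl_meet B x (rl_join B x y) = x" "rl_join B x (rl_meet B x y) = x"
      by (intro sep; simp add: residuated_lattice.meet_absorb[OF A] residuated_lattice.join_absorb[OF A]
          residuated_lattice.meet_comm[OF A] residuated_lattice.join_comm[OF A])+
  next
    fix x y z assume "x \<in> carrier B" "y \<in> carrier B" "z \<in> carrier B"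
    then show "rl_meet B (rl_meet B x y) z = rl_meet B x (rl_meet B y z)"
      "rl_join B (rl_join B x y) z = rl_join B x (rl_join B y z)"
      by (intro sep; simp add: residuated_lattice.meet_assoc[OF A] residuated_lattice.join_assoc[OF A])+
  next
    fix x y z assume "x \<in> carrier B" "y \<in> carrier B" "z \<in> carrier B"
    then show "rl_le B (x \<otimes>\<^bsub>B\<^esub> y) z \<longleftrightarrow> rl_le B x (rl_imp B y z)"
      by (simp add: le residuated_lattice.residuation[OF A])
  next
    fix x assume "x \<in> carrier B"
    then show "rl_le B (rl_bot B) x" "rl_le B x \<one>\<^bsub>B\<^esub>"
      by (simp_all add: le residuated_lattice.bot_least[OF A] residuated_lattice.one_greatest[OF A])
  qed simp_all
qed

section \<open>Products of residuated lattices\<close>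

lemma rl_product_simps:
  "carrier (rl_product I A) = (\<Pi>\<^sub>E i\<in>I. carrier (A i))"
  "x \<otimes>\<^bsub>rl_product I A\<^esub> y = (\<lambda>i\<in>I. x i \<otimes>\<^bsub>A i\<^esub> y i)"
  "\<one>\<^bsub>rl_product I A\<^esub> = (\<lambda>i\<in>I. \<one>\<^bsub>A i\<^esub>)"
  "rl_meet (rl_product I A) x y = (\<lambda>i\<in>I. rl_meet (A i) (x i) (y i))"
  "rl_join (rl_product I A) x y = (\<lambda>i\<in>I. rl_join (A i) (x i) (y i))"
  "rl_imp (rl_product I A) x y = (\<lambda>i\<in>I. rl_imp (A i) (x i) (y i))"
  "rl_bot (rl_product I A) = (\<lambda>i\<in>I. rl_bot (A i))"
  by (simp_all add: rl_product_def)

text \<open>An arbitrary subset \<open>S\<close> is allowed because \<open>rl_hom\<close> constrains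
  values at elements of the source carrier and does not ask that carrier to be closed under the
  operations.\<close>

lemma rl_hom_product_projection:
  assumes "i \<in> I" "S \<subseteq> carrier (rl_product I A)"
  shows "(\<lambda>x. x i) \<in> rl_hom ((rl_product I A)\<lparr>carrier := S\<rparr>) (A i)"
  using assms by (auto simp: rl_hom_def rl_product_simps)

lemma rl_hom_into_product:
  assumes "\<And>i. i \<in> I \<Longrightarrow> f i \<in> rl_hom L (A i)"
  shows "(\<lambda>x. \<lambda>i\<in>I. f i x) \<in> rl_hom L (rl_product I A)"
  using rl_homD[OF assms] by (auto simp: rl_hom_def rl_product_simps fun_eq_iff)

lemma residuated_lattice_rl_product:
  assumes A: "\<And>i. i \<in> I \<Longrightarrow> residuated_lattice (A i)"
  shows "residuated_lattice (rl_product I A)"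
proof (rule residuated_lattice_if_separating_homs[where A = A and I = I and h = "\<lambda>i x. x i"])
  show "rl_subalgebra (carrier (rl_product I A)) (rl_product I A)"
    using rl_subalgebraD[OF residuated_lattice.rl_subalgebra_carrier[OF A]]
    by (auto simp: rl_subalgebra_def rl_product_simps PiE_iff)
  show "(\<lambda>x. x i) \<in> rl_hom (rl_product I A) (A i)" if "i \<in> I" for i
    using that by (auto simp: rl_hom_def rl_product_simps)
  show "x = y" if "x \<in> carrier (rl_product I A)" "y \<in> carrier (rl_product I A)"
    "\<And>i. i \<in> I \<Longrightarrow> x i = y i" for x y
    using that by (auto simp: rl_product_simps intro: PiE_ext)
qed (rule A)

section \<open>Finite quotients and their copies over the natural numbers\<close>

text \<open>Transport of structure along \<open>g\<close>. The set \<open>S\<close> is given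
  separately from \<open>A\<close> so that the image of a homomorphism, possibly a proper subalgebra
  of \<open>A\<close>, can be copied directly.\<close>

definition rl_copy :: "('b \<Rightarrow> 'c) \<Rightarrow> 'b set \<Rightarrow> 'b reslat \<Rightarrow> 'c reslat"
  where "rl_copy g S A =
    (let k = inv_into S g in
    \<lparr>carrier = g ` S,
     mult = (\<lambda>x y. g (k x \<otimes>\<^bsub>A\<^esub> k y)),
     one = g \<one>\<^bsub>A\<^esub>,
     rl_meet = (\<lambda>x y. g (rl_meet A (k x) (k y))),
     rl_join = (\<lambda>x y. g (rl_join A (k x) (k y))),
     rl_imp = (\<lambda>x y. g (rl_imp A (k x) (k y))),
     rl_bot = g (rl_bot A)\<rparr>)"

lemma carrier_rl_copy: "carrier (rl_copy g S A) = g ` S"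
  by (simp add: rl_copy_def Let_def)

lemma rl_hom_rl_copy:
  assumes "inj_on g S"
  shows "g \<in> rl_hom (A\<lparr>carrier := S\<rparr>) (rl_copy g S A)"
  using assms by (simp add: rl_hom_def rl_copy_def Let_def)

text \<open>The inverse \<open>inv_into S g\<close> is an injective homomorphism from the copy back
  into \<open>A\<close>, hence a separating family on its own.\<close>

lemma residuated_lattice_rl_copy:
  assumes A: "residuated_lattice A" and S: "rl_subalgebra S A" and g: "inj_on g S"
  shows "residuated_lattice (rl_copy g S A)"
proof (rule residuated_lattice_if_separating_homs
    [where A = "\<lambda>_. A" and I = "UNIV :: unit set" and h = "\<lambda>_. inv_into S g"])
  note closed = rl_subalgebraD[OF S]
  show "rl_subalgebra (carrier (rl_copy g S A)) (rl_copy g S A)"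
    using closed g by (auto simp: rl_subalgebra_def rl_copy_def Let_def)
  show "inv_into S g \<in> rl_hom (rl_copy g S A) A"
    using closed g by (auto simp: rl_hom_def rl_copy_def Let_def)
  show "x = y" if "x \<in> carrier (rl_copy g S A)" "y \<in> carrier (rl_copy g S A)"
    "\<And>i::unit. i \<in> UNIV \<Longrightarrow> inv_into S g x = inv_into S g y" for x y
    using that by (auto simp: carrier_rl_copy g)
qed (rule A)

text \<open>Surjectivity makes the algebra depend, up to isomorphism, only on the kernel of the map,
  and lets its elements be lifted to \<open>L\<close>.\<close>

definition finite_continuous_quotient :: "'a reslat \<Rightarrow> 'a topology \<Rightarrow> 'b reslat \<Rightarrow> ('a \<Rightarrow> 'b) \<Rightarrow> bool"
  where "finite_continuous_quotient L T A \<phi> \<longleftrightarrow> finite_residuated_lattice A \<and> \<phi> \<in> rl_hom L A \<and>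
    continuous_map T (discrete_topology (carrier A)) \<phi> \<and> \<phi> ` carrier L = carrier A"

text \<open>Being a relation on \<open>L\<close>, the kernel allows quotients with different target
  algebras to be compared.\<close>

definition hom_kernel :: "'a reslat \<Rightarrow> ('a \<Rightarrow> 'b) \<Rightarrow> 'a rel"
  where "hom_kernel L \<phi> = {(x, y). x \<in> carrier L \<and> y \<in> carrier L \<and> \<phi> x = \<phi> y}"

text \<open>The image of the homomorphism is a finite subalgebra, which injects into the natural
  numbers. Corestricting to the image and composing with an injection leave the kernel
  unchanged.\<close>

lemma finite_quotient_over_nat:
  assumes L: "residuated_lattice L" and A: "finite_residuated_lattice A"
    and hom: "\<phi> \<in> rl_hom L A"
    and top: "topspace T = carrier L"
    and cont: "continuous_map T (discrete_topology (carrier A)) \<phi>"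
  obtains B :: "nat reslat" and \<psi>
  where "finite_continuous_quotient L T B \<psi>" "hom_kernel L \<psi> = hom_kernel L \<phi>"
proof -
  let ?S = "\<phi> ` carrier L"
  have S: "rl_subalgebra ?S A"
    using residuated_lattice.rl_subalgebra_carrier[OF L] hom by (rule rl_subalgebra_image)
  have sub: "?S \<subseteq> carrier A"
    using rl_homD(1)[OF hom] by blast
  then have fin: "finite ?S"
    using A finite_subset by (auto simp: finite_residuated_lattice_def)
  then obtain g :: "'b \<Rightarrow> nat" where g: "inj_on g ?S"
    by (metis finite_imp_inj_to_nat_seg)
  let ?B = "rl_copy g ?S A" and ?\<psi> = "\<lambda>x. g (\<phi> x)"
  have hom': "\<phi> \<in> rl_hom L (A\<lparr>carrier := ?S\<rparr>)"
    using hom by (auto simp: rl_hom_def)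
  \<comment> \<open>A subspace of a discrete space is discrete, so \<open>\<phi>\<close> stays
    continuous as a map onto its image, and every map out of that image is continuous.\<close>
  have "continuous_map T (discrete_topology ?S) \<phi>"
    using continuous_map_into_subtopology[OF cont, of ?S] sub top
    by (simp add: inf.absorb2 subtopology_discrete_topology)
  then have "continuous_map T (discrete_topology (carrier ?B)) (g \<circ> \<phi>)"
    by (rule continuous_map_compose) (simp add: carrier_rl_copy)
  moreover have "finite_residuated_lattice ?B"
    using residuated_lattice_rl_copy[OF _ S g] A fin
    by (simp add: finite_residuated_lattice_def carrier_rl_copy)
  ultimately have "finite_continuous_quotient L T ?B ?\<psi>"
    using rl_hom_compose[OF hom' rl_hom_rl_copy[OF g]]
    by (simp add: finite_continuous_quotient_def carrier_rl_copy image_image comp_def)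
  moreover have "hom_kernel L ?\<psi> = hom_kernel L \<phi>"
    using g by (auto simp: hom_kernel_def inj_on_def)
  ultimately show ?thesis
    by (rule that)
qed

lemma residually_finite_over_nat:
  assumes L: "residuated_lattice L" and top: "topspace T = carrier L"
    and rf: "residually_finite TYPE('b) L T"
  shows "residually_finite TYPE(nat) L T"
  unfolding residually_finite_def
proof (intro ballI impI)
  fix x y assume xy: "x \<in> carrier L" "y \<in> carrier L" "x \<noteq> y"
  then obtain A :: "'b reslat" and \<phi> where *: "finite_residuated_lattice A" "\<phi> \<in> rl_hom L A"
    "continuous_map T (discrete_topology (carrier A)) \<phi>" "\<phi> x \<noteq> \<phi> y"
    using rf unfolding residually_finite_def by blast
  obtain B :: "nat reslat" and \<psi>
    where B: "finite_continuous_quotient L T B \<psi>" "hom_kernel L \<psi> = hom_kernel L \<phi>"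
    by (rule finite_quotient_over_nat[OF L *(1,2) top *(3)])
  \<comment> \<open>Maps with equal kernels separate the same pairs.\<close>
  have "(x, y) \<notin> hom_kernel L \<psi>"
    using *(4) unfolding B(2) by (simp add: hom_kernel_def)
  then have "\<psi> x \<noteq> \<psi> y"
    using xy by (simp add: hom_kernel_def)
  with B(1) show "\<exists>(B :: nat reslat) \<psi>. finite_residuated_lattice B \<and> \<psi> \<in> rl_hom L B \<and>
      continuous_map T (discrete_topology (carrier B)) \<psi> \<and> \<psi> x \<noteq> \<psi> y"
    by (auto simp: finite_continuous_quotient_def)
qed

section \<open>From a product back to residual finiteness\<close>

text \<open>Distinct elements of a product differ in a coordinate, and the projection to it is a
  continuous homomorphism to a finite algebra. Inverse limits and closed subdirect products are both
  covered, as subsets of a product.\<close>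

lemma residually_finite_if_iso_subset_product:
  fixes A :: "'i \<Rightarrow> 'b reslat"
  assumes A: "\<forall>i\<in>I. finite_residuated_lattice (A i)"
    and S: "S \<subseteq> carrier (rl_product I A)"
    and iso: "topologically_isomorphic L T ((rl_product I A)\<lparr>carrier := S\<rparr>)
      (subtopology (discrete_product_topology I A) S)"
  shows "residually_finite TYPE('b) L T"
  unfolding residually_finite_def
proof (intro ballI impI)
  fix x y assume xy: "x \<in> carrier L" "y \<in> carrier L" "x \<noteq> y"
  obtain f where f: "f \<in> rl_hom L ((rl_product I A)\<lparr>carrier := S\<rparr>)" "bij_betw f (carrier L) S"
    "homeomorphic_map T (subtopology (discrete_product_topology I A) S) f"
    using iso by (auto simp: topologically_isomorphic_def)
  have "f x \<in> S" "f y \<in> S" "f x \<noteq> f y"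
    using f(2) xy by (auto simp: bij_betw_def inj_on_def)
  \<comment> \<open>Elements of the product agree outside \<open>I\<close> by extensionality, so the
    difference shows at an index in \<open>I\<close>.\<close>
  then obtain i where i: "i \<in> I" "f x i \<noteq> f y i"
    using S by (metis PiE_ext rl_product_simps(1) subsetD)
  have "continuous_map (subtopology (discrete_product_topology I A) S)
      (discrete_topology (carrier (A i))) (\<lambda>x. x i)"
    unfolding discrete_product_topology_def
    by (intro continuous_map_from_subtopology continuous_map_product_projection i(1))
  then have "continuous_map T (discrete_topology (carrier (A i))) (\<lambda>x. f x i)"
    using continuous_map_compose[OF homeomorphic_imp_continuous_map[OF f(3)]]
    by (fastforce simp: comp_def)
  moreover have "(\<lambda>x. f x i) \<in> rl_hom L (A i)"
    using f(1) rl_hom_product_projection[OF i(1) S] by (rule rl_hom_compose)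
  ultimately show "\<exists>(A :: 'b reslat) \<phi>. finite_residuated_lattice A \<and> \<phi> \<in> rl_hom L A \<and>
      continuous_map T (discrete_topology (carrier A)) \<phi> \<and> \<phi> x \<noteq> \<phi> y"
    using A i by blast
qed

lemma residually_finite_if_profinite:
  assumes "profinite TYPE('i) TYPE('b) L T"
  shows "residually_finite TYPE('b) L T"
proof -
  obtain I :: "'i set" and r and A :: "'i \<Rightarrow> 'b reslat" and p
    where A: "\<forall>i\<in>I. finite_residuated_lattice (A i)"
    and iso: "topologically_isomorphic L T ((rl_product I A)\<lparr>carrier := inverse_limit_set I r A p\<rparr>)
      (subtopology (discrete_product_topology I A) (inverse_limit_set I r A p))"
    using assms unfolding profinite_def by blast
  show ?thesis
    using A _ iso by (rule residually_finite_if_iso_subset_product) (auto simp: inverse_limit_set_def)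
qed

lemma residually_finite_if_iso_closed_subdirect_product:
  assumes "iso_closed_subdirect_product TYPE('i) TYPE('b) L T"
  shows "residually_finite TYPE('b) L T"
proof -
  obtain I :: "'i set" and A :: "'i \<Rightarrow> 'b reslat" and S
    where A: "\<forall>i\<in>I. finite_residuated_lattice (A i)" and S: "closed_subdirect_product I A S"
    and iso: "topologically_isomorphic L T ((rl_product I A)\<lparr>carrier := S\<rparr>)
      (subtopology (discrete_product_topology I A) S)"
    using assms unfolding iso_closed_subdirect_product_def by blast
  show ?thesis
    using A _ iso by (rule residually_finite_if_iso_subset_product)
      (use S in \<open>auto simp: closed_subdirect_product_def rl_subalgebra_def\<close>)
qed

section \<open>The inverse limit of all finite continuous quotients\<close>

text \<open>One construction serves both (ii) and (iii): as the canonical map is onto the limit, the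
  limit is a compact image of \<open>L\<close> and projects onto every factor.\<close>

lemma compact_residually_finite_inverse_limit:
  fixes L :: "'a reslat"
  assumes L: "residuated_lattice L" and top: "topspace T = carrier L" and comp: "compact_space T"
    and rf: "residually_finite TYPE(nat) L T"
  obtains I :: "'a rel set" and r and A :: "'a rel \<Rightarrow> nat reslat" and p
  where "\<forall>i\<in>I. finite_residuated_lattice (A i)" "inverse_system I r A p"
    "closed_subdirect_product I A (inverse_limit_set I r A p)"
    "topologically_isomorphic L T ((rl_product I A)\<lparr>carrier := inverse_limit_set I r A p\<rparr>)
        (subtopology (discrete_product_topology I A) (inverse_limit_set I r A p))"
proof -
  \<comment> \<open>Indexing by kernels instead of homomorphisms identifies quotients that differ
    only by an isomorphism, so that inclusion is a partial order on the indices.\<close>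
  define I where "I = {hom_kernel L \<phi> |(B :: nat reslat) \<phi>. finite_continuous_quotient L T B \<phi>}"
  have "\<forall>i\<in>I. \<exists>(B :: nat reslat) \<phi>. finite_continuous_quotient L T B \<phi> \<and> hom_kernel L \<phi> = i"
    by (auto simp: I_def)
  then obtain A :: "'a rel \<Rightarrow> nat reslat" and \<phi>
    where quot: "\<And>i. i \<in> I \<Longrightarrow> finite_continuous_quotient L T (A i) (\<phi> i)"
    and ker: "\<And>i. i \<in> I \<Longrightarrow> hom_kernel L (\<phi> i) = i"
    by metis
  have fin: "finite_residuated_lattice (A i)" and hom: "\<phi> i \<in> rl_hom L (A i)"
    and cont: "continuous_map T (discrete_topology (carrier (A i))) (\<phi> i)"
    and surj: "\<phi> i ` carrier L = carrier (A i)" if "i \<in> I" for i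
    using quot[OF that] by (auto simp: finite_continuous_quotient_def)
  have eq_iff: "\<phi> i x = \<phi> i y \<longleftrightarrow> (x, y) \<in> i"
    if "i \<in> I" "x \<in> carrier L" "y \<in> carrier L" for i x y
    using that ker[of i] by (auto simp: hom_kernel_def)
  \<comment> \<open>Finer quotients are larger: \<open>j\<close> lies below \<open>i\<close> when
    the kernel \<open>i\<close> is contained in \<open>j\<close>.\<close>
  define r where "r = {(j, i). j \<in> I \<and> i \<in> I \<and> i \<subseteq> j}"
  \<comment> \<open>An element of \<open>A i\<close> is lifted to \<open>L\<close> and mapped on to
    \<open>A j\<close>. The choice of the lift does not matter if \<open>i\<close> is contained in
    \<open>j\<close>: two lifts are related by \<open>i\<close>, hence by \<open>j\<close>.\<close>
  define p where "p = (\<lambda>i j a. \<phi> j (inv_into (carrier L) (\<phi> i) a))"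
  have p: "p i j (\<phi> i x) = \<phi> j x" if "(j, i) \<in> r" "x \<in> carrier L" for i j x
  proof -
    let ?y = "inv_into (carrier L) (\<phi> i) (\<phi> i x)"
    have "?y \<in> carrier L" "\<phi> i ?y = \<phi> i x"
      using that(2) by (simp_all add: inv_into_into f_inv_into_f)
    then show ?thesis
      using that eq_iff unfolding p_def r_def by blast
  qed
  text \<open>The case \<open>J = {}\<close> yields an index at all, namely the kernel of the map to the one-element algebra.\<close>
  have directed: "\<exists>k\<in>I. \<forall>j\<in>J. (j, k) \<in> r" if J: "finite J" "J \<subseteq> I" for J
  proof -
    \<comment> \<open>The kernel of \<open>?f\<close> is the intersection of the kernels in
      \<open>J\<close>, and consists of all pairs over the carrier if \<open>J\<close> is
      empty.\<close>
    let ?P = "rl_product J A" and ?f = "\<lambda>x. \<lambda>j\<in>J. \<phi> j x"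
    have P: "finite_residuated_lattice ?P"
      using fin J by (auto simp: finite_residuated_lattice_def rl_product_simps subset_iff
          intro!: residuated_lattice_rl_product finite_PiE)
    have f: "?f \<in> rl_hom L ?P"
      using hom J by (intro rl_hom_into_product) auto
    have "continuous_map T (discrete_product_topology J A) ?f"
      using cont J unfolding discrete_product_topology_def
      by (subst continuous_map_componentwise) auto
    \<comment> \<open>A finite Hausdorff space is discrete, and the product is finite because
      \<open>J\<close> and all factors are.\<close>
    moreover have "discrete_product_topology J A = discrete_topology (carrier ?P)"
      using P unfolding discrete_product_topology_def
      by (intro finite_t1_space_imp_discrete_topology Hausdorff_imp_t1_space)
        (auto simp: Hausdorff_space_product_topology rl_product_simps finite_residuated_lattice_def)
    ultimately have "continuous_map T (discrete_topology (carrier ?P)) ?f"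
      by simp
    \<comment> \<open>The map \<open>?f\<close> need not be onto the product; its image, copied to
      the natural numbers, is a quotient whose kernel is an index.\<close>
    then obtain B :: "nat reslat" and \<psi>
      where B: "finite_continuous_quotient L T B \<psi>" "hom_kernel L \<psi> = hom_kernel L ?f"
      by (rule finite_quotient_over_nat[OF L P f top])
    have "hom_kernel L ?f \<subseteq> j" if "j \<in> J" for j
    proof -
      have "hom_kernel L ?f \<subseteq> hom_kernel L (\<phi> j)"
        using that by (auto simp: hom_kernel_def dest: fun_cong[where x = j])
      then show ?thesis
        using ker J that by auto
    qed
    moreover have "hom_kernel L \<psi> \<in> I"
      using B(1) by (auto simp: I_def)
    ultimately show ?thesis
      using B(2) J by (intro bexI[of _ "hom_kernel L \<psi>"]) (auto simp: r_def)
  qed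
  have sys: "inverse_system I r A p"
    unfolding inverse_system_def directed_poset_def
  proof (intro conjI ballI allI impI)
    show "I \<noteq> {}"
      using directed[of "{}"] by blast
    show "partial_order_on I r"
      by (auto simp: partial_order_on_def preorder_on_def refl_on_def trans_def antisym_def r_def)
    show "\<exists>k\<in>I. (i, k) \<in> r \<and> (j, k) \<in> r" if "i \<in> I" "j \<in> I" for i j
      using directed[of "{i, j}"] that by auto
    show "residuated_lattice (A i)" if "i \<in> I" for i
      using fin[OF that] by (simp add: finite_residuated_lattice_def)
    show "p i i a = a" if "i \<in> I" "a \<in> carrier (A i)" for i a
      using that surj[OF that(1)] p[of i i] by (force simp: r_def)
    show "p j k (p i j a) = p i k a"
      if kj: "(k, j) \<in> r" and ji: "(j, i) \<in> r" and a: "a \<in> carrier (A i)" for i j k a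
    proof -
      obtain x where x: "x \<in> carrier L" "a = \<phi> i x"
        using a surj[of i] ji by (auto simp: r_def)
      have "(k, i) \<in> r"
        using kj ji by (auto simp: r_def)
      with x kj ji show ?thesis
        by (simp add: p)
    qed
    show "p i j \<in> rl_hom (A i) (A j)" if ji: "(j, i) \<in> r" for i j
    proof -
      have ij: "i \<in> I" "j \<in> I"
        using ji by (auto simp: r_def)
      note hi = rl_homD[OF hom[OF ij(1)]] and hj = rl_homD[OF hom[OF ij(2)]]
      note closed = rl_subalgebraD[OF residuated_lattice.rl_subalgebra_carrier[OF L]]
      have "p i j a \<in> carrier (A j)" if "a \<in> carrier (A i)" for a
        using that surj[OF ij(1)] p[OF ji] hj(1) by force
      moreover have "p i j (rl_meet (A i) a b) = rl_meet (A j) (p i j a) (p i j b) \<and>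
          p i j (rl_join (A i) a b) = rl_join (A j) (p i j a) (p i j b) \<and>
          p i j (a \<otimes>\<^bsub>A i\<^esub> b) = p i j a \<otimes>\<^bsub>A j\<^esub> p i j b \<and>
          p i j (rl_imp (A i) a b) = rl_imp (A j) (p i j a) (p i j b)"
        if ab: "a \<in> carrier (A i)" "b \<in> carrier (A i)" for a b
      proof -
        obtain x y where xy: "x \<in> carrier L" "y \<in> carrier L" and a: "a = \<phi> i x" and b: "b = \<phi> i y"
          using ab surj[OF ij(1)] by blast
        show ?thesis
          \<comment> \<open>The operations of \<open>A i\<close> are pulled back to \<open>L\<close>
            along \<open>\<phi> i\<close>, since \<open>p i j\<close> is only known on values of
            \<open>\<phi> i\<close>; then \<open>\<phi> j\<close> carries them to
            \<open>A j\<close>.\<close>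
          unfolding a b hi(2-5)[OF xy, symmetric]
          by (simp add: p[OF ji] xy closed hj)
      qed
      moreover have "p i j (rl_bot (A i)) = rl_bot (A j) \<and> p i j \<one>\<^bsub>A i\<^esub> = \<one>\<^bsub>A j\<^esub>"
        unfolding hi(6,7)[symmetric] by (simp add: p[OF ji] closed hj)
      ultimately show ?thesis
        by (simp add: rl_hom_def)
    qed
  qed
  define e where "e = (\<lambda>x. \<lambda>i\<in>I. \<phi> i x)"
  define S where "S = inverse_limit_set I r A p"
  let ?D = "discrete_product_topology I A"
  have Ir: "i \<in> I" "j \<in> I" if "(j, i) \<in> r" for i j
    using that by (auto simp: r_def)
  have e_hom: "e \<in> rl_hom L (rl_product I A)"
    unfolding e_def using hom by (rule rl_hom_into_product)
  have e_image: "e ` carrier L = S"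
  proof
    show "e ` carrier L \<subseteq> S"
      using rl_homD(1)[OF e_hom] p Ir by (auto simp: S_def inverse_limit_set_def e_def)
    show "S \<subseteq> e ` carrier L"
    proof
      fix b assume b: "b \<in> S"
      have bA: "b i \<in> carrier (A i)" if "i \<in> I" for i
        using b that by (auto simp: S_def inverse_limit_set_def rl_product_simps)
      have bp: "p i j (b i) = b j" if "(j, i) \<in> r" for i j
        using b that by (auto simp: S_def inverse_limit_set_def)
      \<comment> \<open>These are the fibres over the coordinates of \<open>b\<close>, closed
        because points of a discrete space are closed. A point common to all of them is a preimage
        of \<open>b\<close>.\<close>
      define F where "F = (\<lambda>i. {x \<in> topspace T. \<phi> i x \<in> {b i}})"
      have closed: "closedin T (F i)" if "i \<in> I" for i
        unfolding F_def using cont[OF that] bA[OF that]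
        by (intro closedin_continuous_map_preimage[where Y = "discrete_topology (carrier (A i))"]) auto
      have fip: "\<Inter>(F ` J) \<noteq> {}" if J: "finite J" "J \<subseteq> I" for J
      proof -
        \<comment> \<open>An index \<open>k\<close> above all of \<open>J\<close> reduces finitely
          many conditions to one: applying \<open>p k j\<close> to \<open>\<phi> k x = b k\<close>
          gives the condition at \<open>j\<close>.\<close>
        obtain k where k: "k \<in> I" "\<forall>j\<in>J. (j, k) \<in> r"
          using directed[OF J] by blast
        obtain x where x: "x \<in> carrier L" "\<phi> k x = b k"
          using surj[OF k(1)] bA[OF k(1)] by (metis imageE)
        have "x \<in> F j" if "j \<in> J" for j
          using x p[of j k x] bp[of j k] k that top by (simp add: F_def)
        then show ?thesis
          by blast
      qed
      have "\<Inter>(F ` I) \<noteq> {}"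
        using comp[unfolded compact_space_fip, rule_format, of "F ` I"] closed fip
        by (auto simp: all_finite_subset_image)
      then obtain x where x: "\<And>i. i \<in> I \<Longrightarrow> x \<in> F i"
        by blast
      \<comment> \<open>The common point is known to lie in \<open>L\<close> only through membership
        in some fibre, so an index must exist.\<close>
      obtain k where "k \<in> I"
        using directed[of "{}"] by blast
      then have "x \<in> carrier L"
        using x[of k] top by (simp add: F_def)
      moreover have "e x = b"
      proof (rule PiE_ext)
        show "e x \<in> (\<Pi>\<^sub>E i\<in>I. carrier (A i))"
          using rl_homD(1)[OF e_hom] \<open>x \<in> carrier L\<close> by (simp add: rl_product_simps)
        show "b \<in> (\<Pi>\<^sub>E i\<in>I. carrier (A i))"
          using b by (simp add: S_def inverse_limit_set_def rl_product_simps)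
        show "e x i = b i" if "i \<in> I" for i
          using x[OF that] that by (simp add: e_def F_def)
      qed
      ultimately show "b \<in> e ` carrier L"
        by blast
    qed
  qed
  have e_inj: "inj_on e (carrier L)"
  proof (rule inj_onI, rule ccontr)
    fix x y assume xy: "x \<in> carrier L" "y \<in> carrier L" "e x = e y" "x \<noteq> y"
    then obtain B :: "nat reslat" and \<psi> where *: "finite_residuated_lattice B" "\<psi> \<in> rl_hom L B"
      "continuous_map T (discrete_topology (carrier B)) \<psi>" "\<psi> x \<noteq> \<psi> y"
      using rf unfolding residually_finite_def by blast
    obtain C :: "nat reslat" and \<eta>
      where C: "finite_continuous_quotient L T C \<eta>" "hom_kernel L \<eta> = hom_kernel L \<psi>"
      by (rule finite_quotient_over_nat[OF L *(1,2) top *(3)])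
    let ?k = "hom_kernel L \<eta>"
    have k: "?k \<in> I"
      using C(1) by (auto simp: I_def)
    moreover have "(x, y) \<notin> ?k"
      using *(4) unfolding C(2) by (simp add: hom_kernel_def)
    \<comment> \<open>The map chosen for the index \<open>?k\<close> may differ from
      \<open>\<eta>\<close>, but it has the same kernel and so separates \<open>x\<close> and
      \<open>y\<close> too.\<close>
    ultimately have "\<phi> ?k x \<noteq> \<phi> ?k y"
      using eq_iff xy by blast
    then show False
      using fun_cong[OF xy(3), of ?k] k by (simp add: e_def)
  qed
  have S_sub: "S \<subseteq> topspace ?D"
    by (auto simp: S_def inverse_limit_set_def rl_product_simps discrete_product_topology_def)
  have haus: "Hausdorff_space ?D"
    by (simp add: discrete_product_topology_def Hausdorff_space_product_topology)
  have e_cont: "continuous_map T ?D e"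
    using cont unfolding discrete_product_topology_def e_def
    by (subst continuous_map_componentwise) auto
  then have "homeomorphic_map T (subtopology ?D S) e"
    using comp haus e_image e_inj S_sub top
    by (intro continuous_imp_homeomorphic_map)
      (auto simp: continuous_map_in_subtopology Hausdorff_space_subtopology)
  moreover have "e \<in> rl_hom L ((rl_product I A)\<lparr>carrier := S\<rparr>)"
    using e_hom e_image by (auto simp: rl_hom_def rl_product_def)
  ultimately have "topologically_isomorphic L T ((rl_product I A)\<lparr>carrier := S\<rparr>) (subtopology ?D S)"
    using e_image e_inj by (auto simp: topologically_isomorphic_def bij_betw_def)
  moreover have "closed_subdirect_product I A S"
    unfolding closed_subdirect_product_def
  proof (intro conjI ballI)
    show "rl_subalgebra S (rl_product I A)"
      using rl_subalgebra_image[OF residuated_lattice.rl_subalgebra_carrier[OF L] e_hom] e_image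
      by simp
    have "compactin ?D (e ` topspace T)"
      using comp e_cont by (intro image_compactin) (simp_all add: compact_space_def)
    then show "closedin ?D S"
      using haus e_image top by (simp add: compactin_imp_closedin)
    \<comment> \<open>Each element of \<open>A i\<close> is \<open>\<phi> i x\<close> for some
      \<open>x\<close> in \<open>L\<close>, hence a coordinate of the compatible family
      \<open>e x\<close>.\<close>
    show "(\<lambda>x. x i) ` S = carrier (A i)" if "i \<in> I" for i
      using surj[OF that] that by (simp add: e_image[symmetric] image_image e_def)
  qed
  ultimately show ?thesis
    using fin sys by (intro that[of I A r p]) (auto simp: S_def)
qed

section \<open>The equivalence over fixed and over arbitrary types\<close>

text \<open>The first two conjuncts give the equivalence with algebras over \<open>nat\<close> and
  indices in \<open>'a rel\<close>. The other three show that these types lose nothing: a condition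
  that holds over any types \<open>'b\<close> and \<open>'i\<close> holds over the fixed ones. Every
  implication passes through residual finiteness over \<open>nat\<close>.\<close>

theorem theorem3p14:
  fixes L :: "'a reslat" and T :: "'a topology"
  assumes "topological_residuated_lattice L T" and "compact_space T"
  shows
    "(residually_finite TYPE(nat) L T \<longleftrightarrow> profinite TYPE('a rel) TYPE(nat) L T) \<and>
     (residually_finite TYPE(nat) L T \<longleftrightarrow> iso_closed_subdirect_product TYPE('a rel) TYPE(nat) L T) \<and>
     (residually_finite TYPE('b) L T \<longrightarrow> residually_finite TYPE(nat) L T) \<and>
     (profinite TYPE('i) TYPE('b) L T \<longrightarrow> profinite TYPE('a rel) TYPE(nat) L T) \<and>
     (iso_closed_subdirect_product TYPE('i) TYPE('b) L T \<longrightarrow>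
        iso_closed_subdirect_product TYPE('a rel) TYPE(nat) L T)"
proof -
  have L: "residuated_lattice L" and top: "topspace T = carrier L"
    using assms(1) by (auto simp: topological_residuated_lattice_def)
  note nat = residually_finite_over_nat[OF L top]
  have "profinite TYPE('a rel) TYPE(nat) L T \<and> iso_closed_subdirect_product TYPE('a rel) TYPE(nat) L T"
    if rf: "residually_finite TYPE(nat) L T"
  proof -
    obtain I :: "'a rel set" and r and A :: "'a rel \<Rightarrow> nat reslat" and p
      where "\<forall>i\<in>I. finite_residuated_lattice (A i)" "inverse_system I r A p"
        "closed_subdirect_product I A (inverse_limit_set I r A p)"
        "topologically_isomorphic L T ((rl_product I A)\<lparr>carrier := inverse_limit_set I r A p\<rparr>)
            (subtopology (discrete_product_topology I A) (inverse_limit_set I r A p))"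
      by (rule compact_residually_finite_inverse_limit[OF L top assms(2) rf])
    then show ?thesis
      unfolding profinite_def iso_closed_subdirect_product_def by blast
  qed
  moreover have "residually_finite TYPE(nat) L T"
    if "profinite TYPE('a rel) TYPE(nat) L T \<or> iso_closed_subdirect_product TYPE('a rel) TYPE(nat) L T"
    using that residually_finite_if_profinite residually_finite_if_iso_closed_subdirect_product
    by blast
  moreover have "residually_finite TYPE(nat) L T"
    if "residually_finite TYPE('b) L T \<or> profinite TYPE('i) TYPE('b) L T \<or>
      iso_closed_subdirect_product TYPE('i) TYPE('b) L T"
    using that nat residually_finite_if_profinite residually_finite_if_iso_closed_subdirect_product
    by blast
  ultimately show ?thesis
    by blast
qed

end
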